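(* Let $K_0,K_1\ge0$ be integers, let $M_0,M_1\ge 0$ be real numbers, let $h_0>0$, and put $h_1=h_0(M_0+K_0+1)$, $\Delta t=h_2=h_0(M_0+K_0+1)(M_1+K_1+1)$. Then the Telescopic Projective Forward Euler (TPFE) method with two inner layers of step sizes $h_0,h_1$ and outer step size $\Delta t=h_2$, written as a Runge-Kutta method with Butcher tableau $(\overline c,\overline A,\overline b)$ with $(K_0+1)(K_1+1)$ stages (defined in the context), is consistent, i.e. each row sum of $\overline A$ equals the corresponding entry of $\overline c$, and first order accurate, i.e. the sum of all entries of $\overline b$ equals $1$.
   Context: An explicit Runge-Kutta method with $N$ stages for $u'=f(u)$ is given by a Butcher tableau $(c,A,b)$ with $c,b\in\mathbb{R}^N$ and $A\in\mathbb{R}^{N\times N}$ strictly lower triangular. It is called consistent if $\sum_{j=1}^{i-1}a_{i,j}=c_i$ for all $i$; it satisfies the first-order accuracy condition if $\sum_j b_j=1$. The TPFE method with two inner layers nests projective forward Euler steps: a step of size $h_1$ consists of $K_0+1$ forward Euler steps of size $h_0$ followed by an extrapolation of length $M_0h_0$ along the slope of the last of these; a step of size $h_2=\Delta t$ consists of $K_1+1$ such steps of size $h_1$ followed by an extrapolation of length $M_1h_1$ along the difference quotient of the last of these. Put $\lambda_i=h_i/\Delta t$ for $i=0,1$. Written as a Runge-Kutta method with step size $\Delta t$, its stages are indexed by pairs $(j,k)$, $0\le j\le K_1$, $0\le k\le K_0$, ordered lexicographically, and its tableau $(\overline c,\overline A,\overline b)$ is: - $\overline c_{(j,k)}=j\lambda_1+k\lambda_0$.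 - $\overline A_{(j,k),(j,m)}=\lambda_0$ if $m<k$, and $0$ if $m\ge k$. - For $i<j$: $\overline A_{(j,k),(i,m)}=\lambda_0$ if $m<K_0$, and $\overline A_{(j,k),(i,K_0)}=\lambda_0(1+M_0)$. - $\overline A_{(j,k),(i,m)}=0$ for $i>j$. - For $0\le j\le K_1-1$: $\overline b_{(j,m)}=\lambda_0$ if $m<K_0$, and $\overline b_{(j,K_0)}=\lambda_0(1+M_0)$. - $\overline b_{(K_1,m)}=\lambda_0(1+M_1)$ if $m<K_0$, and $\overline b_{(K_1,K_0)}=\lambda_0(1+M_1)(1+M_0)$. *)

theory Defs
  imports Complex_Main
begin

text \<open>Stages are numbered from 0, so that \<^term>\<open>{..<i}\<close> is the set of stages preceding stage \<open>i\<close>.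
  Only entries with indices below \<open>stages T\<close> are meaningful.\<close>

record butcher_tableau =
  stages :: nat
  nodes :: "nat \<Rightarrow> real"
  coeffs :: "nat \<Rightarrow> nat \<Rightarrow> real"
  weights :: "nat \<Rightarrow> real"

definition explicit_rk :: "butcher_tableau \<Rightarrow> bool" where
  "explicit_rk T \<longleftrightarrow> (\<forall>i<stages T. \<forall>j<stages T. i \<le> j \<longrightarrow> coeffs T i j = 0)"

definition consistent_rk :: "butcher_tableau \<Rightarrow> bool" where
  "consistent_rk T \<longleftrightarrow> (\<forall>i<stages T. (\<Sum>j<i. coeffs T i j) = nodes T i)"

definition first_order_rk :: "butcher_tableau \<Rightarrow> bool" where
  "first_order_rk T \<longleftrightarrow> (\<Sum>j<stages T. weights T j) = 1"

lemma consistent_rk_iff_row_sums: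
  assumes "explicit_rk T"
  shows "consistent_rk T \<longleftrightarrow> (\<forall>i<stages T. (\<Sum>j<stages T. coeffs T i j) = nodes T i)"
proof -
  have "(\<Sum>j<i. coeffs T i j) = (\<Sum>j<stages T. coeffs T i j)" if "i < stages T" for i
    using that assms by (intro sum.mono_neutral_left) (auto simp: explicit_rk_def)
  then show ?thesis by (auto simp: consistent_rk_def)
qed

definition tpfe_c :: "real \<Rightarrow> real \<Rightarrow> nat \<Rightarrow> nat \<Rightarrow> real" where
  "tpfe_c l0 l1 j k = real j * l1 + real k * l0"

text \<open>The arguments \<open>j k i m\<close> are the row index \<open>(j,k)\<close> followed by the column index \<open>(i,m)\<close>.\<close>

definition tpfe_A :: "nat \<Rightarrow> real \<Rightarrow> real \<Rightarrow> nat \<Rightarrow> nat \<Rightarrow> nat \<Rightarrow> nat \<Rightarrow> real" where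
  "tpfe_A K0 M0 l0 j k i m =
     (if i = j then (if m < k then l0 else 0)
      else if i < j then (if m < K0 then l0 else l0 * (1 + M0))
      else 0)"

definition tpfe_b :: "nat \<Rightarrow> nat \<Rightarrow> real \<Rightarrow> real \<Rightarrow> real \<Rightarrow> nat \<Rightarrow> nat \<Rightarrow> real" where
  "tpfe_b K0 K1 M0 M1 l0 j m =
     (if j < K1 then (if m < K0 then l0 else l0 * (1 + M0))
      else (if m < K0 then l0 * (1 + M1) else l0 * (1 + M1) * (1 + M0)))"

text \<open>The pairs \<open>(j,k)\<close> with \<open>j \<le> K1\<close> and \<open>k \<le> K0\<close> are enumerated lexicographically:
  \<open>(j,k)\<close> is stage \<open>s = j * (K0 + 1) + k\<close>, so \<open>j = s div (K0 + 1)\<close> and \<open>k = s mod (K0 + 1)\<close>.\<close>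

definition tpfe_tableau ::
    "nat \<Rightarrow> nat \<Rightarrow> real \<Rightarrow> real \<Rightarrow> real \<Rightarrow> real \<Rightarrow> real \<Rightarrow> butcher_tableau" where
  "tpfe_tableau K0 K1 M0 M1 h0 h1 \<Delta>t =
     (let l0 = h0 / \<Delta>t; l1 = h1 / \<Delta>t in
      \<lparr> stages = (K0 + 1) * (K1 + 1),
        nodes = (\<lambda>s. tpfe_c l0 l1 (s div (K0 + 1)) (s mod (K0 + 1))),
        coeffs = (\<lambda>s t. tpfe_A K0 M0 l0 (s div (K0 + 1)) (s mod (K0 + 1))
                                        (t div (K0 + 1)) (t mod (K0 + 1))),
        weights = (\<lambda>s. tpfe_b K0 K1 M0 M1 l0 (s div (K0 + 1)) (s mod (K0 + 1))) \<rparr>)"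

lemma explicit_tpfe_tableau: "explicit_rk (tpfe_tableau K0 K1 M0 M1 h0 h1 \<Delta>t)"
proof -
  have "tpfe_A K0 M0 l (s div (K0 + 1)) (s mod (K0 + 1)) (t div (K0 + 1)) (t mod (K0 + 1)) = 0"
    if "s \<le> t" for s t l
  proof -
    have le: "s div (K0 + 1) \<le> t div (K0 + 1)"
      using that by (rule div_le_mono)
    have "s mod (K0 + 1) \<le> t mod (K0 + 1)" if eq: "s div (K0 + 1) = t div (K0 + 1)"
    proof -
      have "s div (K0 + 1) * (K0 + 1) + s mod (K0 + 1) \<le> t div (K0 + 1) * (K0 + 1) + t mod (K0 + 1)"
        using \<open>s \<le> t\<close> by (simp only: div_mult_mod_eq)
      then show ?thesis unfolding eq by simp
    qed
    with le show ?thesis by (auto simp: tpfe_A_def)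
  qed
  then show ?thesis
    by (simp add: explicit_rk_def tpfe_tableau_def Let_def)
qed

end

theory Submission
  imports Defs
begin

text \<open>A full block of \<open>K0 + 1\<close> stages contributes \<open>\<lambda>0 * (K0 + 1 + M0) = \<lambda>1\<close> to every later row.
  So row \<open>(j,k)\<close> sums to \<open>j * \<lambda>1 + k * \<lambda>0\<close>, and the weights sum to \<open>(K1 + 1 + M1) * \<lambda>1 = 1\<close>, because
  the last block is scaled by \<open>1 + M1\<close>.\<close>

text \<open>The indices below \<open>j * n + k\<close> form \<open>j\<close> full blocks of length
  \<open>n\<close> and an initial piece of block \<open>j\<close>. Allowing \<open>k = n\<close>
  makes that piece a whole block, which the weight sum needs.\<close>

lemma sum_lexicographic:
  fixes f :: "nat \<Rightarrow> nat \<Rightarrow> 'a::comm_monoid_add"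
  assumes "k \<le> n"
  shows "(\<Sum>t<j * n + k. f (t div n) (t mod n)) = (\<Sum>i<j. \<Sum>m<n. f i m) + (\<Sum>m<k. f j m)"
proof -
  have partial: "(\<Sum>t<j * n + k. f (t div n) (t mod n)) =
      (\<Sum>t<j * n. f (t div n) (t mod n)) + (\<Sum>m<k. f j m)" if "k \<le> n" for j k
    using that by (induction k) (auto simp: add.assoc)
  have "(\<Sum>t<j * n. f (t div n) (t mod n)) = (\<Sum>i<j. \<Sum>m<n. f i m)"
  proof (induction j)
    case (Suc j)
    \<comment> \<open>\<open>partial\<close> at \<open>k = n\<close> splits off block
      \<open>j\<close> as a whole.\<close>
    then show ?case using partial[of n j] by (simp add: add.commute)
  qed simp
  then show ?thesis using partial[OF assms] by simp
qed

lemma sum_block: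
  fixes l M :: real
  shows "(\<Sum>m<K + 1. if m < K then l else l * (1 + M)) = l * (M + real K + 1)"
  by (simp add: algebra_simps)

lemma tpfe_A_row_sum:
  assumes "k \<le> K0"
  shows "(\<Sum>t<j * (K0 + 1) + k. tpfe_A K0 M0 l0 j k (t div (K0 + 1)) (t mod (K0 + 1))) =
    tpfe_c l0 (l0 * (M0 + real K0 + 1)) j k"
proof -
  have "(\<Sum>m<K0 + 1. tpfe_A K0 M0 l0 j k i m) = l0 * (M0 + real K0 + 1)" if "i < j" for i
    unfolding sum_block[symmetric] using that by (intro sum.cong) (auto simp: tpfe_A_def)
  moreover have "(\<Sum>m<k. tpfe_A K0 M0 l0 j k j m) = real k * l0"
    by (simp add: tpfe_A_def)
  ultimately show ?thesis
    using assms by (subst sum_lexicographic) (auto simp: tpfe_c_def)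
qed

lemma tpfe_b_sum:
  "(\<Sum>t<(K0 + 1) * (K1 + 1). tpfe_b K0 K1 M0 M1 l0 (t div (K0 + 1)) (t mod (K0 + 1))) =
    l0 * (M0 + real K0 + 1) * (M1 + real K1 + 1)"
proof -
  \<comment> \<open>Block \<open>K1\<close> is separated because only its weights carry the factor
    \<open>1 + M1\<close>.\<close>
  have stages: "(K0 + 1) * (K1 + 1) = K1 * (K0 + 1) + (K0 + 1)"
    by simp
  have inner: "(\<Sum>m<K0 + 1. tpfe_b K0 K1 M0 M1 l0 j m) = l0 * (M0 + real K0 + 1)" if "j < K1" for j
    unfolding sum_block[symmetric] using that by (intro sum.cong) (auto simp: tpfe_b_def)
  have last: "(\<Sum>m<K0 + 1. tpfe_b K0 K1 M0 M1 l0 K1 m) = l0 * (1 + M1) * (M0 + real K0 + 1)"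
    \<comment> \<open>Here \<open>sum_block\<close> is used with
      \<open>l = l0 * (1 + M1)\<close>.\<close>
    unfolding sum_block[symmetric] by (intro sum.cong) (auto simp: tpfe_b_def)
  have "(\<Sum>t<(K0 + 1) * (K1 + 1). tpfe_b K0 K1 M0 M1 l0 (t div (K0 + 1)) (t mod (K0 + 1))) =
      (\<Sum>j<K1. \<Sum>m<K0 + 1. tpfe_b K0 K1 M0 M1 l0 j m) + (\<Sum>m<K0 + 1. tpfe_b K0 K1 M0 M1 l0 K1 m)"
    unfolding stages by (rule sum_lexicographic) simp
  also have "\<dots> = (\<Sum>j<K1. l0 * (M0 + real K0 + 1)) + l0 * (1 + M1) * (M0 + real K0 + 1)"
    unfolding last by (intro arg_cong2[where f = "(+)"] sum.cong refl inner) simp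
  also have "\<dots> = l0 * (M0 + real K0 + 1) * (M1 + real K1 + 1)"
    by (simp add: algebra_simps)
  finally show ?thesis .
qed

theorem theorem3:
  fixes K0 K1 :: nat and M0 M1 h0 h1 \<Delta>t :: real
  assumes "M0 \<ge> 0" and "M1 \<ge> 0" and "h0 > 0"
    and "h1 = h0 * (M0 + real K0 + 1)"
    and "\<Delta>t = h0 * (M0 + real K0 + 1) * (M1 + real K1 + 1)"
  shows "consistent_rk (tpfe_tableau K0 K1 M0 M1 h0 h1 \<Delta>t) \<and>
         first_order_rk (tpfe_tableau K0 K1 M0 M1 h0 h1 \<Delta>t)"
proof
  have ratio: "h1 / \<Delta>t = h0 / \<Delta>t * (M0 + real K0 + 1)"
    using assms(4) by simp
  have "(\<Sum>t<s. tpfe_A K0 M0 l0 (s div (K0 + 1)) (s mod (K0 + 1)) (t div (K0 + 1)) (t mod (K0 + 1))) =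
      tpfe_c l0 (l0 * (M0 + real K0 + 1)) (s div (K0 + 1)) (s mod (K0 + 1))" for s :: nat and l0 :: real
    \<comment> \<open>Division with remainder turns the bound \<open>j * (K0 + 1) + k\<close> back
      into \<open>s\<close>; the premise \<open>k \<le> K0\<close> holds because \<open>k\<close> is
      a remainder modulo \<open>K0 + 1\<close>.\<close>
    using tpfe_A_row_sum[where k = "s mod (K0 + 1)" and j = "s div (K0 + 1)" and ?K0.0 = K0 and ?M0.0 = M0]
    by (simp only: div_mult_mod_eq) (simp add: less_Suc_eq_le[symmetric])
  then show "consistent_rk (tpfe_tableau K0 K1 M0 M1 h0 h1 \<Delta>t)"
    unfolding consistent_rk_def tpfe_tableau_def Let_def ratio by simp
  \<comment> \<open>Positivity permits cancelling \<open>\<Delta>t\<close> in the weight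
    sum.\<close>
  have "\<Delta>t > 0"
    using assms by simp
  then have "h0 / \<Delta>t * (M0 + real K0 + 1) * (M1 + real K1 + 1) = 1"
    by (simp flip: assms(5))
  then show "first_order_rk (tpfe_tableau K0 K1 M0 M1 h0 h1 \<Delta>t)"
    unfolding first_order_rk_def tpfe_tableau_def Let_def
    by (simp only: butcher_tableau.simps tpfe_b_sum)
qed

end
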